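(* For all integers $0\le k\le n$, the handle $\stackrel{\circ}{\Delta}_k\times\Delta_{n-k}$ carries Morse shellable triangulations using a unique critical tile, which is of index $k$. That is, there is a triangulation of the polytope $\Delta_k\times\Delta_{n-k}$ for which the subset $\stackrel{\circ}{\Delta}_k\times\Delta_{n-k}$ admits a Morse shelling having exactly one critical tile, and this tile has index $k$.
   Context: $\Delta_k$ is the closed $k$-simplex and $\stackrel{\circ}{\Delta}_k$ is the open $k$-simplex (a point if $k=0$). A facet of a simplex is a codimension one face. A Morse tile of dimension $n$ and order $k\in\{0,\dots,n+1\}$ is a closed $n$-simplex deprived of $k$ of its facets together with, if $k\ge 1$, a possibly empty face $\mu$ of codimension at least two (the Morse face); when $\mu$ is non-empty it is understood not to be contained in the removed facets, so that $k-1\le\dim\mu\le n-2$. Critical tiles: the closed simplex is critical of index $0$; the open $n$-simplex (order $n+1$) is critical of index $n$; a Morse tile of order $k$, $1\le k\le n-1$, whose Morse face has dimension $k-1$ is critical of index $k$; all other Morse tiles are regular. Let $K$ be a finite simplicial complex. A Morse tiling of a subset $S\subset|K|$ is a partition of $S$ by Morse tiles, each obtained from a simplex of $K$, such that for every $j\ge 0$ the union of the tiles of dimension $\ge j$ is closed in $S$. A Morse tiled subset of $S$ is a union of tiles closed in $S$. A Morse shelling of $S$ is a Morse tiling together with a filtration $\emptyset\subset S_1\subset\dots\subset S_N=S$ by Morse tiled subsets such that $S_1$ and each $S_i\setminus S_{i-1}$ ($2\le i\le N$) is a single tile. *)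

theory Defs
  imports "HOL-Analysis.Analysis" "HOL-Library.Disjoint_Sets"
begin

text \<open>Faces of codimension one. Unlike \<open>facet_of\<close>, the empty face counts as the
  facet of a point, so that an \<open>n\<close>-simplex has \<open>n + 1\<close> facets also for \<open>n = 0\<close>.\<close>

definition simplex_facets :: "'a::euclidean_space set \<Rightarrow> 'a set set"
  where "simplex_facets s = {F. F face_of s \<and> aff_dim F = aff_dim s - 1}"

text \<open>The data of a Morse tile: an \<open>n\<close>-simplex \<open>s\<close>, the set \<open>R\<close> of its \<open>k\<close> removed facets,
  and the Morse face \<open>\<mu>\<close>, where \<open>\<mu> = {}\<close> means that there is none.\<close>

definition morse_tile_data ::
    "nat \<Rightarrow> nat \<Rightarrow> 'a::euclidean_space set \<Rightarrow> 'a set set \<Rightarrow> 'a set \<Rightarrow> bool"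
  where "morse_tile_data n k s R \<mu> \<longleftrightarrow>
    int n simplex s \<and> R \<subseteq> simplex_facets s \<and> card R = k \<and>
    (\<mu> = {} \<or> k \<ge> 1 \<and> \<mu> face_of s \<and> aff_dim \<mu> \<le> int n - 2 \<and> \<not> \<mu> \<subseteq> \<Union>R)"

definition morse_tile_of :: "'a::euclidean_space set \<Rightarrow> 'a set \<Rightarrow> bool"
  where "morse_tile_of s T \<longleftrightarrow> (\<exists>n k R \<mu>. morse_tile_data n k s R \<mu> \<and> T = s - \<Union>R - \<mu>)"

text \<open>A tile determines its data, and hence its index, as a set. The one exception is a point,
  which arises with order 0 and with order 1, but is critical of index 0 either way.\<close>

definition critical_tile :: "nat \<Rightarrow> 'a::euclidean_space set \<Rightarrow> bool"
  where "critical_tile i T \<longleftrightarrow>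
    (\<exists>n k s R \<mu>. morse_tile_data n k s R \<mu> \<and> T = s - \<Union>R - \<mu> \<and>
      (k = 0 \<and> i = 0 \<or>
       k = n + 1 \<and> i = n \<or>
       1 \<le> k \<and> k < n \<and> aff_dim \<mu> = int k - 1 \<and> i = k))"

text \<open>A tile contains the relative interior of its underlying simplex, so \<open>aff_dim\<close> gives
  the dimension of the tile.\<close>

definition morse_tiling ::
    "'a::euclidean_space set set \<Rightarrow> 'a set \<Rightarrow> 'a set set \<Rightarrow> bool"
  where "morse_tiling K S P \<longleftrightarrow>
    S \<subseteq> \<Union>K \<and> partition_on S P \<and> (\<forall>T\<in>P. \<exists>s\<in>K. morse_tile_of s T) \<and>
    (\<forall>j::nat. closedin (top_of_set S) (\<Union>{T\<in>P. aff_dim T \<ge> int j}))"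

definition morse_tiled_subset :: "'a::euclidean_space set \<Rightarrow> 'a set set \<Rightarrow> 'a set \<Rightarrow> bool"
  where "morse_tiled_subset S P X \<longleftrightarrow> (\<exists>Q\<subseteq>P. X = \<Union>Q) \<and> closedin (top_of_set S) X"

text \<open>The condition at \<open>i = 0\<close> says that the first member \<open>X 1\<close> of the filtration is a single tile.\<close>

definition morse_shelling ::
    "'a::euclidean_space set set \<Rightarrow> 'a set \<Rightarrow> 'a set set \<Rightarrow> nat \<Rightarrow> (nat \<Rightarrow> 'a set) \<Rightarrow> bool"
  where "morse_shelling K S P N X \<longleftrightarrow>
    morse_tiling K S P \<and> X 0 = {} \<and> X N = S \<and>
    (\<forall>i\<in>{1..N}. morse_tiled_subset S P (X i)) \<and>
    (\<forall>i<N. X i \<subset> X (Suc i) \<and> X (Suc i) - X i \<in> P)"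

end

theory Submission
  imports Defs
begin

text \<open>
  Write \<open>l = n - k\<close> and number the vertices of the two simplices.  The vertices of the product form
  the grid \<open>{..k} \<times> {..l}\<close>, and the chains of the grid span the simplices of the staircase
  triangulation; its maximal simplices are the lattice paths from \<open>(0, 0)\<close> to \<open>(k, l)\<close>.  That this
  is a triangulation rests on one fact: nonnegative weights on a chain are determined by their
  marginals, because they form the comonotone coupling
  (\<open>staircase_cumulative\<close>, \<open>ex_staircase_weights\<close>).  So every point of the product has a well-defined
  carrier, a chain, and everything else is a statement about chains.

  A point lies in the handle iff its carrier \<open>c\<close> meets every column \<open>i \<le> k\<close>.  Assign to it the path
  that leaves each column \<open>i < k\<close> at the top of \<open>c\<close> in that column.  This is the only path that
  contains \<open>c\<close> and whose top vertices in the columns before the last all belong to \<open>c\<close>, so the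
  handle is partitioned into one piece per path, consisting of the points whose carrier lies on the
  path, contains those \<open>k\<close> top vertices and meets the last column.  The first condition gives a closed
  simplex, the second removes \<open>k\<close> facets, and the third removes the face spanned by the vertices
  before the last column.  If the path has one vertex in the last column, this face is one more
  facet; otherwise it is a Morse face of codimension at least two.  Each piece is thus a Morse tile of
  order \<open>k\<close> or \<open>k + 1\<close> (\<open>mem_handle_tile_iff\<close>, \<open>morse_tile_data_handle_tile\<close>).

  For \<open>0 < k < n\<close> a tile of order \<open>k + 1\<close> is regular, and one of order \<open>k\<close> is critical iff its Morse
  face has only \<open>k\<close> vertices, that is, iff the path runs along the bottom row and climbs in the last
  column; for \<open>k = 0\<close> and \<open>k = n\<close> there is only one path.  To exclude every other way of reading a
  tile as a critical one, a tile is shown to determine its data (\<open>morse_tile_data_unique\<close>).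

  The closed simplex of a path meets, inside the handle, only tiles of paths that lie weakly below it
  (\<open>handle_tile_meets_geo_path\<close>).  Hence any linear extension of the pointwise order of paths is a
  shelling order.
\<close>

section \<open>A Morse tile determines its data\<close>

lemma proper_face_misses_rel_interior:
  assumes "F face_of s" "aff_dim F < aff_dim s"
  shows "F \<inter> rel_interior s = {}"
  using face_of_disjoint_rel_interior[OF assms(1)] assms(2) by auto

lemma morse_tile_dataD:
  assumes "morse_tile_data n k s R \<mu>"
  shows "convex s" "closed s" "aff_dim s = int n"
proof -
  have "int n simplex s"
    using assms by (simp add: morse_tile_data_def)
  then show "convex s" "closed s" "aff_dim s = int n"
    by (rule convex_simplex closed_simplex aff_dim_simplex)+
qed

lemma morse_tile_between:
  assumes "morse_tile_data n k s R \<mu>" "T = s - \<Union>R - \<mu>"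
  shows "rel_interior s \<subseteq> T" "T \<subseteq> s"
proof -
  note dim = morse_tile_dataD(3)[OF assms(1)]
  have "F \<inter> rel_interior s = {}" if "F \<in> R" for F
    using that assms(1) dim by (intro proper_face_misses_rel_interior) (auto simp: morse_tile_data_def simplex_facets_def)
  moreover have "\<mu> \<inter> rel_interior s = {}"
    using assms(1) dim by (cases "\<mu> = {}") (auto simp: morse_tile_data_def intro!: proper_face_misses_rel_interior)
  ultimately show "rel_interior s \<subseteq> T"
    using rel_interior_subset assms(2) by blast
  show "T \<subseteq> s"
    using assms(2) by blast
qed

lemma closure_morse_tile:
  assumes "morse_tile_data n k s R \<mu>" "T = s - \<Union>R - \<mu>"
  shows "closure T = s"
proof -
  note s = morse_tile_dataD(1,2)[OF assms(1)]
  have "closure (rel_interior s) \<subseteq> closure T" "closure T \<subseteq> closure s"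
    by (rule closure_mono[OF morse_tile_between(1)[OF assms]] closure_mono[OF morse_tile_between(2)[OF assms]])+
  then show ?thesis
    using s by (simp add: convex_closure_rel_interior)
qed

lemma aff_dim_morse_tile:
  assumes "morse_tile_data n k s R \<mu>" "T = s - \<Union>R - \<mu>"
  shows "aff_dim T = int n"
  using morse_tile_dataD(3)[OF assms(1)] unfolding closure_morse_tile[OF assms, symmetric] closure_aff_dim .

text \<open>A face missing from the tile lies in a removed facet or in the Morse face, because its
  relative interior meets one of them.\<close>

lemma face_missing_morse_tile:
  assumes data: "morse_tile_data n k s R \<mu>"
    and G: "G face_of s" "G \<noteq> {}" "G \<inter> (s - \<Union>R - \<mu>) = {}"
  shows "(\<exists>F\<in>R. G \<subseteq> F) \<or> G \<subseteq> \<mu>"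
proof -
  have "convex G" "G \<subseteq> s"
    using G face_of_imp_convex face_of_imp_subset by blast+
  then obtain z where z: "z \<in> rel_interior G"
    using G(2) rel_interior_eq_empty by blast
  then have "z \<in> \<Union>R \<or> z \<in> \<mu>"
    using G \<open>G \<subseteq> s\<close> rel_interior_subset by blast
  moreover have "G \<subseteq> H" if "H face_of s" "z \<in> H" for H
    using subset_of_face_of that z \<open>G \<subseteq> s\<close> by blast
  ultimately show ?thesis
    using data unfolding morse_tile_data_def simplex_facets_def by blast
qed

text \<open>The simplex is the closure of the tile, the removed facets are the facets disjoint from
  the tile, and the Morse face is then the largest missing face that lies in no removed facet.  A
  point escapes this argument: its only facet is empty, hence disjoint from the tile whether it is
  removed or not.\<close>

lemma morse_tile_data_unique:
  assumes data: "morse_tile_data n k s R \<mu>" and data': "morse_tile_data n' k' s' R' \<mu>'"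
    and eq: "s - \<Union>R - \<mu> = s' - \<Union>R' - \<mu>'" and "n \<ge> 1"
  shows "n' = n" "k' = k" "s' = s" "R' = R" "\<mu>' = \<mu>"
proof -
  show s: "s' = s"
    using closure_morse_tile[OF data refl] closure_morse_tile[OF data' refl] eq by simp
  show n: "n' = n"
    using aff_dim_morse_tile[OF data refl] aff_dim_morse_tile[OF data' refl] eq by simp
  have facets: "Q = {F \<in> simplex_facets s. F \<inter> (s - \<Union>Q - \<nu>) = {}}"
    if "morse_tile_data n m s Q \<nu>" for m Q \<nu>
  proof -
    note dim = morse_tile_dataD(1,3)[OF that]
    have "F \<in> Q" if F: "F face_of s" "aff_dim F = int n - 1" "F \<inter> (s - \<Union>Q - \<nu>) = {}" for F
    proof -
      have "F \<noteq> {}"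
        using F(2) \<open>n \<ge> 1\<close> by auto
      have "\<not> F \<subseteq> \<nu>"
      proof
        assume "F \<subseteq> \<nu>"
        then have "aff_dim F \<le> aff_dim \<nu>"
          by (rule aff_dim_subset)
        then show False
          using \<open>morse_tile_data n m s Q \<nu>\<close> F(2) \<open>F \<subseteq> \<nu>\<close> \<open>F \<noteq> {}\<close> by (auto simp: morse_tile_data_def)
      qed
      then obtain H where H: "H \<in> Q" "F \<subseteq> H"
        using face_missing_morse_tile[OF \<open>morse_tile_data n m s Q \<nu>\<close> F(1) \<open>F \<noteq> {}\<close> F(3)] by blast
      have "H face_of s" "aff_dim H = int n - 1"
        using H \<open>morse_tile_data n m s Q \<nu>\<close> dim by (auto simp: morse_tile_data_def simplex_facets_def)
      then have "F face_of H" "convex H"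
        using F(1) H(2) face_of_subset face_of_imp_subset face_of_imp_convex by blast+
      then have "F = H"
        using face_of_aff_dim_lt F(2) \<open>aff_dim H = int n - 1\<close> by fastforce
      then show ?thesis
        using H by simp
    qed
    then show ?thesis
      using that dim by (auto simp: morse_tile_data_def simplex_facets_def)
  qed
  show R: "R' = R"
    using facets[of k R \<mu>] facets[of k' R' \<mu>'] data data' eq s n by simp
  show k: "k' = k"
    using data data' R by (simp add: morse_tile_data_def)
  have sub: "\<nu> \<subseteq> \<nu>'"
    if d: "morse_tile_data n k s R \<nu>" "morse_tile_data n k s R \<nu>'"
      and e: "s - \<Union>R - \<nu> = s - \<Union>R - \<nu>'" for \<nu> \<nu>'
  proof (cases "\<nu> = {}")
    case False
    then have "\<nu> face_of s" "\<not> (\<exists>F\<in>R. \<nu> \<subseteq> F)"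
      using d(1) by (auto simp: morse_tile_data_def)
    then show ?thesis
      using face_missing_morse_tile[OF d(2), of \<nu>] e False by blast
  qed auto
  show "\<mu>' = \<mu>"
    using sub[of \<mu> \<mu>'] sub[of \<mu>' \<mu>] data data' eq s n R k by blast
qed

section \<open>Simplicial complexes from unique convex coordinates\<close>

text \<open>Weights vanish outside the index set, so that representations over different index sets can
  be compared as functions.\<close>

definition convex_weights :: "('i \<Rightarrow> 'v::real_vector) \<Rightarrow> 'i set \<Rightarrow> ('i \<Rightarrow> real) \<Rightarrow> 'v \<Rightarrow> bool"
  where "convex_weights v I w p \<longleftrightarrow>
    (\<forall>i. 0 \<le> w i) \<and> (\<forall>i. i \<notin> I \<longrightarrow> w i = 0) \<and> sum w I = 1 \<and> (\<Sum>i\<in>I. w i *\<^sub>R v i) = p"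

lemma convex_weights_mono:
  assumes "convex_weights v I w p" "I \<subseteq> J" "finite J"
  shows "convex_weights v J w p"
proof -
  have "\<forall>i\<in>J - I. w i = 0"
    using assms by (simp add: convex_weights_def)
  then have "sum w J = sum w I" "(\<Sum>i\<in>J. w i *\<^sub>R v i) = (\<Sum>i\<in>I. w i *\<^sub>R v i)"
    using assms by (auto intro!: sum.mono_neutral_right)
  then show ?thesis
    using assms unfolding convex_weights_def by auto
qed

lemma convex_weights_restrict:
  assumes "convex_weights v J w p" "{i. w i \<noteq> 0} \<subseteq> I" "I \<subseteq> J" "finite J"
  shows "convex_weights v I w p"
proof -
  have "sum w J = sum w I" "(\<Sum>i\<in>J. w i *\<^sub>R v i) = (\<Sum>i\<in>I. w i *\<^sub>R v i)"
    using assms by (auto intro!: sum.mono_neutral_right)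
  then show ?thesis
    using assms unfolding convex_weights_def by auto
qed

lemma convex_hull_image_weights:
  assumes "finite I" "inj_on v I"
  shows "p \<in> convex hull (v ` I) \<longleftrightarrow> (\<exists>w. convex_weights v I w p)"
proof
  assume "p \<in> convex hull (v ` I)"
  then obtain u where u: "\<forall>x\<in>v ` I. 0 \<le> u x" "sum u (v ` I) = 1" "(\<Sum>x\<in>v ` I. u x *\<^sub>R x) = p"
    using assms by (auto simp: convex_hull_finite)
  have "convex_weights v I (\<lambda>i. if i \<in> I then u (v i) else 0) p"
    using u assms by (auto simp: convex_weights_def sum.reindex if_distrib cong: sum.cong if_cong)
  then show "\<exists>w. convex_weights v I w p"
    by blast
next
  assume "\<exists>w. convex_weights v I w p"
  then obtain w where w: "convex_weights v I w p" ..
  let ?u = "\<lambda>x. w (the_inv_into I v x)"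
  have "\<forall>x\<in>v ` I. 0 \<le> ?u x" "sum ?u (v ` I) = 1" "(\<Sum>x\<in>v ` I. ?u x *\<^sub>R x) = p"
    using w assms by (auto simp: convex_weights_def sum.reindex the_inv_into_f_f cong: sum.cong)
  then show "p \<in> convex hull (v ` I)"
    using assms by (auto simp: convex_hull_finite)
qed

lemma unique_weights_if_affine_independent:
  assumes "finite I" "inj_on v I" "\<not> affine_dependent (v ` I)"
    and "convex_weights v I w p" "convex_weights v I w' p"
  shows "w = w'"
proof (rule ccontr)
  assume "w \<noteq> w'"
  then obtain i where i: "i \<in> I" "w i \<noteq> w' i"
    using assms(4,5) unfolding convex_weights_def by (metis ext)
  let ?U = "\<lambda>x. w (the_inv_into I v x) - w' (the_inv_into I v x)"
  have "sum ?U (v ` I) = 0" "(\<Sum>x\<in>v ` I. ?U x *\<^sub>R x) = 0"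
    using assms by (auto simp: convex_weights_def sum.reindex the_inv_into_f_f sum_subtractf
        scaleR_diff_left cong: sum.cong)
  moreover have "?U (v i) \<noteq> 0"
    using i assms(2) by (simp add: the_inv_into_f_f)
  ultimately have "affine_dependent (v ` I)"
    using i(1) assms(1) by (subst affine_dependent_explicit_finite) blast+
  then show False
    using assms(3) by simp
qed

text \<open>The converse: the positive and the negative part of an affine dependency, rescaled to total
  weight one, would be two convex representations of the same point.\<close>

lemma affine_independent_if_unique_weights:
  assumes "finite I" "inj_on v I"
    and uniq: "\<And>w w' p. convex_weights v I w p \<Longrightarrow> convex_weights v I w' p \<Longrightarrow> w = w'"
  shows "\<not> affine_dependent (v ` I)"
proof
  assume "affine_dependent (v ` I)"
  then obtain U where "sum U (v ` I) = 0" and "\<exists>x\<in>v ` I. U x \<noteq> 0" and "(\<Sum>x\<in>v ` I. U x *\<^sub>R x) = 0"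
    using assms(1) by (auto simp: affine_dependent_explicit_finite)
  then obtain i where sum0: "(\<Sum>i\<in>I. U (v i)) = 0" and i: "i \<in> I" "U (v i) \<noteq> 0"
    and vec0: "(\<Sum>i\<in>I. U (v i) *\<^sub>R v i) = 0"
    using assms(2) by (auto simp: sum.reindex)
  define pos where "pos j = (if j \<in> I then max (U (v j)) 0 else 0)" for j
  define neg where "neg j = (if j \<in> I then max (- U (v j)) 0 else 0)" for j
  have diff: "U (v j) = pos j - neg j" if "j \<in> I" for j
    using that by (auto simp: pos_def neg_def max_def)
  have ge0: "0 \<le> pos j" "0 \<le> neg j" for j
    by (auto simp: pos_def neg_def)
  define s where "s = sum pos I"
  have "sum pos I - sum neg I = 0"
    using sum0 diff by (simp add: sum_subtractf)
  then have s: "sum neg I = s"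
    by (simp add: s_def)
  have "(\<Sum>j\<in>I. pos j *\<^sub>R v j) - (\<Sum>j\<in>I. neg j *\<^sub>R v j) = 0"
    using vec0 diff by (simp add: sum_subtractf scaleR_diff_left)
  then have vec: "(\<Sum>j\<in>I. neg j *\<^sub>R v j) = (\<Sum>j\<in>I. pos j *\<^sub>R v j)"
    by simp
  have "0 < pos i + neg i"
    using i by (auto simp: pos_def neg_def max_def)
  moreover have "pos i \<le> sum pos I" "neg i \<le> sum neg I"
    using i(1) assms(1) ge0 by (auto intro: member_le_sum)
  ultimately have "s > 0"
    using s by (simp add: s_def)
  let ?p = "(1 / s) *\<^sub>R (\<Sum>j\<in>I. pos j *\<^sub>R v j)"
  have "convex_weights v I (\<lambda>j. pos j / s) ?p"
    using \<open>s > 0\<close> ge0 by (auto simp: convex_weights_def pos_def s_def scaleR_sum_right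
        simp flip: sum_divide_distrib intro!: sum.cong)
  moreover have "convex_weights v I (\<lambda>j. neg j / s) ?p"
    unfolding vec[symmetric]
    using \<open>s > 0\<close> ge0 s by (auto simp: convex_weights_def neg_def scaleR_sum_right
        simp flip: sum_divide_distrib intro!: sum.cong)
  ultimately have "(\<lambda>j. pos j / s) = (\<lambda>j. neg j / s)"
    by (rule uniq)
  then have "pos i / s = neg i / s"
    by meson
  then show False
    using \<open>s > 0\<close> diff[OF i(1)] i(2) by simp
qed

text \<open>An abstract complex \<open>C\<close> and a placement \<open>v\<close> of its vertices such that no point has two
  convex representations by vertices of members of \<open>C\<close>.  This single condition makes the vertices of
  each member affinely independent and makes the simplices meet along common faces.\<close>

locale unique_coordinates =
  fixes C :: "'i set set" and v :: "'i \<Rightarrow> 'v::euclidean_space"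
  assumes finite_complex: "finite C"
    and finite_member: "c \<in> C \<Longrightarrow> finite c"
    and subset_closed: "c \<in> C \<Longrightarrow> d \<subseteq> c \<Longrightarrow> d \<in> C"
    and unique_weights: "c \<in> C \<Longrightarrow> c' \<in> C \<Longrightarrow>
      convex_weights v c w p \<Longrightarrow> convex_weights v c' w' p \<Longrightarrow> w = w'"
begin

definition geo :: "'i set \<Rightarrow> 'v set"
  where "geo c = convex hull (v ` c)"

definition realization :: "'v set"
  where "realization = \<Union>(geo ` C)"

text \<open>The vertices of the smallest simplex containing a point.  Outside \<open>realization\<close> the value
  is arbitrary.\<close>

definition carrier_face :: "'v \<Rightarrow> 'i set"
  where "carrier_face p = {i. (SOME w. \<exists>c\<in>C. convex_weights v c w p) i \<noteq> 0}"

lemma carrier_face_eq: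
  assumes "c \<in> C" "convex_weights v c w p"
  shows "carrier_face p = {i. w i \<noteq> 0}"
proof -
  have "(SOME w. \<exists>c\<in>C. convex_weights v c w p) = w"
    using assms unique_weights by (intro some_equality) blast+
  then show ?thesis
    by (simp add: carrier_face_def)
qed

lemma inj_on_member:
  assumes "c \<in> C"
  shows "inj_on v c"
proof
  fix i j assume ij: "i \<in> c" "j \<in> c" "v i = v j"
  have unit: "convex_weights v c (\<lambda>x. if x = i then 1 else 0) (v i)" if "i \<in> c" for i
    using that finite_member[OF assms]
    by (auto simp: convex_weights_def if_distrib[of "\<lambda>r. r *\<^sub>R _"] cong: if_cong)
  have "(\<lambda>x. if x = i then 1 else (0::real)) = (\<lambda>x. if x = j then 1 else 0)"
    using unit[OF ij(1)] unit[OF ij(2)] ij(3) by (intro unique_weights[OF assms assms]) auto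
  from fun_cong[OF this, of i] show "i = j"
    by (simp split: if_splits)
qed

lemma geo_iff_weights: "c \<in> C \<Longrightarrow> p \<in> geo c \<longleftrightarrow> (\<exists>w. convex_weights v c w p)"
  unfolding geo_def by (intro convex_hull_image_weights finite_member inj_on_member)

lemma affine_independent_member: "c \<in> C \<Longrightarrow> \<not> affine_dependent (v ` c)"
  by (rule affine_independent_if_unique_weights[OF finite_member inj_on_member unique_weights])

lemma simplex_geo: "c \<in> C \<Longrightarrow> (int (card c) - 1) simplex geo c"
  unfolding geo_def using affine_independent_member[of c] card_image[OF inj_on_member, of c]
  by (intro simplex_convex_hull) auto

lemma geo_subset_realization: "c \<in> C \<Longrightarrow> geo c \<subseteq> realization"
  by (auto simp: realization_def)

lemma weights_of_point:
  assumes "p \<in> realization"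
  obtains c w where "c \<in> C" "convex_weights v c w p" "carrier_face p = {i. w i \<noteq> 0}"
proof -
  obtain c where c: "c \<in> C" "p \<in> geo c"
    using assms by (auto simp: realization_def)
  then obtain w where "convex_weights v c w p"
    by (auto simp: geo_iff_weights)
  then show ?thesis
    using that c(1) carrier_face_eq by simp
qed

lemma carrier_face_in:
  assumes "p \<in> realization"
  shows "carrier_face p \<in> C" "carrier_face p \<noteq> {}"
proof -
  obtain c w where c: "c \<in> C" "convex_weights v c w p" and eq: "carrier_face p = {i. w i \<noteq> 0}"
    using assms by (rule weights_of_point)
  have "{i. w i \<noteq> 0} \<subseteq> c"
    using c(2) by (auto simp: convex_weights_def)
  then show "carrier_face p \<in> C"
    using c(1) eq subset_closed by simp
  show "carrier_face p \<noteq> {}"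
  proof
    assume "carrier_face p = {}"
    then have "w = (\<lambda>_. 0)"
      using eq by auto
    then show False
      using c(2) by (simp add: convex_weights_def)
  qed
qed

lemma mem_geo_iff:
  assumes "c \<in> C"
  shows "p \<in> geo c \<longleftrightarrow> p \<in> realization \<and> carrier_face p \<subseteq> c"
proof
  assume p: "p \<in> geo c"
  then obtain w where w: "convex_weights v c w p"
    using assms geo_iff_weights by blast
  then have "carrier_face p \<subseteq> c"
    using carrier_face_eq[OF assms w] by (auto simp: convex_weights_def)
  then show "p \<in> realization \<and> carrier_face p \<subseteq> c"
    using p geo_subset_realization[OF assms] by blast
next
  assume p: "p \<in> realization \<and> carrier_face p \<subseteq> c"
  then obtain d w where d: "d \<in> C" "convex_weights v d w p" and eq: "carrier_face p = {i. w i \<noteq> 0}"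
    using weights_of_point by blast
  have "carrier_face p \<subseteq> d"
    using d(2) eq by (auto simp: convex_weights_def)
  have "convex_weights v (carrier_face p) w p"
    by (rule convex_weights_restrict[OF d(2)]) (use d(1) eq finite_member \<open>carrier_face p \<subseteq> d\<close> in auto)
  then have "convex_weights v c w p"
    by (rule convex_weights_mono) (use p finite_member[OF assms] in auto)
  then show "p \<in> geo c"
    using assms geo_iff_weights by blast
qed

text \<open>The barycenter has positive weight at every vertex.\<close>

lemma ex_point_with_carrier:
  assumes "c \<in> C" "c \<noteq> {}"
  shows "\<exists>p\<in>geo c. carrier_face p = c"
proof -
  let ?w = "\<lambda>i. if i \<in> c then 1 / real (card c) else 0"
  have "card c > 0"
    using assms finite_member by (simp add: card_gt_0_iff)
  then have w: "convex_weights v c ?w (\<Sum>i\<in>c. ?w i *\<^sub>R v i)"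
    by (auto simp: convex_weights_def)
  then have "carrier_face (\<Sum>i\<in>c. ?w i *\<^sub>R v i) = c"
    using carrier_face_eq[OF assms(1) w] \<open>card c > 0\<close> by auto
  then show ?thesis
    using w assms(1) geo_iff_weights by blast
qed

lemma geo_subset_iff:
  assumes "c \<in> C" "d \<in> C"
  shows "geo c \<subseteq> geo d \<longleftrightarrow> c \<subseteq> d"
proof
  assume "geo c \<subseteq> geo d"
  then show "c \<subseteq> d"
    using ex_point_with_carrier[OF assms(1)] mem_geo_iff[OF assms(2)] by (cases "c = {}") auto
next
  assume "c \<subseteq> d"
  then show "geo c \<subseteq> geo d"
    unfolding geo_def by (intro hull_mono image_mono)
qed

lemma face_of_geo_iff:
  assumes "c \<in> C"
  shows "F face_of geo c \<longleftrightarrow> (\<exists>d\<subseteq>c. F = geo d)"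
  unfolding geo_def face_of_convex_hull_affine_independent[OF affine_independent_member[OF assms]]
  by (metis subset_image_iff)

text \<open>A point common to \<open>geo c\<close> and \<open>geo c'\<close> has its carrier in both \<open>c\<close> and \<open>c'\<close>, so the
  intersection is \<open>geo (c \<inter> c')\<close>.\<close>

lemma simplicial_complex_geo: "simplicial_complex (geo ` C)"
  unfolding simplicial_complex_def
proof (intro conjI allI impI ballI)
  show "finite (geo ` C)"
    by (simp add: finite_complex)
  show "\<exists>n. n simplex S" if "S \<in> geo ` C" for S
    using that simplex_geo by blast
  show "F \<in> geo ` C" if "S \<in> geo ` C \<and> F face_of S" for F S
    using that face_of_geo_iff subset_closed by blast
  show "S \<inter> S' face_of S" if SS: "S \<in> geo ` C \<and> S' \<in> geo ` C" for S S'
  proof -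
    obtain c c' where c: "c \<in> C" "S = geo c" "c' \<in> C" "S' = geo c'"
      using SS by blast
    have "c \<inter> c' \<in> C"
      using subset_closed[OF c(1)] by simp
    then have "S \<inter> S' = geo (c \<inter> c')"
      using c by (auto simp: mem_geo_iff)
    then show ?thesis
      using c face_of_geo_iff by blast
  qed
qed

lemma aff_dim_geo: "c \<in> C \<Longrightarrow> aff_dim (geo c) = int (card c) - 1"
  by (rule aff_dim_simplex[OF simplex_geo])

text \<open>A facet is removed by asking for the opposite vertex, a face \<open>d\<close> by asking for a vertex
  outside \<open>d\<close>; this turns tiles into conditions on carriers.\<close>

definition tile :: "'i set \<Rightarrow> 'i set \<Rightarrow> 'i set \<Rightarrow> 'v set"
  where "tile c E d = geo c - \<Union>((\<lambda>i. geo (c - {i})) ` E) - geo d"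

lemma mem_tile_iff:
  assumes "c \<in> C" "d \<subseteq> c"
  shows "p \<in> tile c E d \<longleftrightarrow>
    p \<in> realization \<and> carrier_face p \<subseteq> c \<and> E \<subseteq> carrier_face p \<and> \<not> carrier_face p \<subseteq> d"
proof -
  have "d \<in> C" "\<And>i. c - {i} \<in> C"
    using assms subset_closed by blast+
  then show ?thesis
    using assms(1) unfolding tile_def by (auto simp: mem_geo_iff)
qed

text \<open>The condition \<open>E \<subseteq> d\<close> says that \<open>d\<close> lies in none of the removed facets: its barycenter
  uses all the vertices opposite to them.\<close>

lemma morse_tile_data_tile:
  assumes c: "c \<in> C" "E \<subseteq> c" "d \<subseteq> c" and "c \<noteq> {}"
    and d: "d = {} \<or> E \<noteq> {} \<and> E \<subseteq> d \<and> card d + 2 \<le> card c"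
  shows "morse_tile_data (card c - 1) (card E) (geo c) ((\<lambda>i. geo (c - {i})) ` E) (geo d)"
proof -
  have mem: "d \<in> C" "\<And>i. c - {i} \<in> C"
    using c subset_closed by blast+
  have card: "int (card c - 1) = int (card c) - 1"
    using c(1) \<open>c \<noteq> {}\<close> finite_member by (simp add: card_gt_0_iff of_nat_diff Suc_leI)
  have "inj_on (\<lambda>i. geo (c - {i})) E"
  proof
    fix i j assume ij: "i \<in> E" "j \<in> E" "geo (c - {i}) = geo (c - {j})"
    then have "c - {i} = c - {j}"
      using geo_subset_iff mem(2) by (metis subset_antisym order_refl)
    then show "i = j"
      using ij c(2) by blast
  qed
  moreover have "geo (c - {i}) \<in> simplex_facets (geo c)" if "i \<in> E" for i
  proof -
    have "i \<in> c" "finite c"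
      using that c finite_member by auto
    then have "int (card (c - {i})) = int (card c) - 1"
      using card_Suc_Diff1[of c i] by simp
    then show ?thesis
      using c(1) mem(2) by (auto simp: simplex_facets_def face_of_geo_iff aff_dim_geo)
  qed
  moreover have "geo d = {} \<or> card E \<ge> 1 \<and> geo d face_of geo c \<and>
      aff_dim (geo d) \<le> int (card c - 1) - 2 \<and> \<not> geo d \<subseteq> (\<Union>i\<in>E. geo (c - {i}))"
  proof (cases "d = {}")
    case False
    then have dE: "E \<noteq> {}" "E \<subseteq> d" "card d + 2 \<le> card c"
      using d by auto
    have "card E \<ge> 1"
      using dE(1) c finite_member by (simp add: Suc_le_eq card_gt_0_iff finite_subset)
    moreover have "geo d face_of geo c"
      using c face_of_geo_iff by blast
    moreover have "aff_dim (geo d) \<le> int (card c - 1) - 2"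
      using dE(3) card aff_dim_geo[OF mem(1)] by simp
    moreover obtain p where p: "p \<in> geo d" "carrier_face p = d"
      using ex_point_with_carrier[OF mem(1) False] by blast
    then have "p \<notin> geo (c - {i})" if "i \<in> E" for i
      using that dE(2) mem_geo_iff[OF mem(2)] by blast
    then have "\<not> geo d \<subseteq> (\<Union>i\<in>E. geo (c - {i}))"
      using p(1) by blast
    ultimately show ?thesis
      by blast
  qed (simp add: geo_def)
  ultimately show ?thesis
    unfolding morse_tile_data_def using simplex_geo[OF c(1)] card by (auto simp: card_image)
qed

end

section \<open>The staircase triangulation of a product of two simplices\<close>

lemma convex_weights_product_iff:
  assumes "finite I" "finite J" and w: "\<And>e. 0 \<le> w e" "\<And>e. e \<notin> I \<times> J \<Longrightarrow> w e = 0"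
  shows "convex_weights (\<lambda>(i, j). (a i, b j)) (I \<times> J) w (x, y) \<longleftrightarrow>
    convex_weights a I (\<lambda>i. \<Sum>j\<in>J. w (i, j)) x \<and> convex_weights b J (\<lambda>j. \<Sum>i\<in>I. w (i, j)) y"
proof -
  have 1: "sum w (I \<times> J) = (\<Sum>i\<in>I. \<Sum>j\<in>J. w (i, j))"
    by (simp add: sum.cartesian_product)
  have 2: "sum w (I \<times> J) = (\<Sum>j\<in>J. \<Sum>i\<in>I. w (i, j))"
    unfolding 1 by (rule sum.swap)
  have 3: "fst (\<Sum>e\<in>I \<times> J. w e *\<^sub>R (case e of (i, j) \<Rightarrow> (a i, b j))) = (\<Sum>i\<in>I. (\<Sum>j\<in>J. w (i, j)) *\<^sub>R a i)"
    by (simp add: fst_sum scaleR_sum_left sum.cartesian_product split_def)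
  have "snd (\<Sum>e\<in>I \<times> J. w e *\<^sub>R (case e of (i, j) \<Rightarrow> (a i, b j))) = (\<Sum>i\<in>I. \<Sum>j\<in>J. w (i, j) *\<^sub>R b j)"
    by (simp add: snd_sum sum.cartesian_product split_def)
  also have "\<dots> = (\<Sum>j\<in>J. (\<Sum>i\<in>I. w (i, j)) *\<^sub>R b j)"
    unfolding scaleR_sum_left by (rule sum.swap)
  finally have 4: "snd (\<Sum>e\<in>I \<times> J. w e *\<^sub>R (case e of (i, j) \<Rightarrow> (a i, b j))) = (\<Sum>j\<in>J. (\<Sum>i\<in>I. w (i, j)) *\<^sub>R b j)" .
  have vec: "(\<Sum>e\<in>I \<times> J. w e *\<^sub>R (case e of (i, j) \<Rightarrow> (a i, b j))) = (x, y) \<longleftrightarrow>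
      (\<Sum>i\<in>I. (\<Sum>j\<in>J. w (i, j)) *\<^sub>R a i) = x \<and> (\<Sum>j\<in>J. (\<Sum>i\<in>I. w (i, j)) *\<^sub>R b j) = y"
    unfolding prod_eq_iff 3 4 by simp
  have nonneg: "\<forall>i. 0 \<le> (\<Sum>j\<in>J. w (i, j))" "\<forall>j. 0 \<le> (\<Sum>i\<in>I. w (i, j))"
    by (simp_all add: sum_nonneg w(1))
  have out: "\<forall>i. i \<notin> I \<longrightarrow> (\<Sum>j\<in>J. w (i, j)) = 0" "\<forall>j. j \<notin> J \<longrightarrow> (\<Sum>i\<in>I. w (i, j)) = 0"
    by (auto intro!: sum.neutral w(2))
  show ?thesis
    unfolding convex_weights_def vec 1[symmetric] 2[symmetric] using w nonneg out by blast
qed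

text \<open>These are the chains of the grid for the product order, because two vertices in the same
  column are always comparable.\<close>

definition staircases :: "nat \<Rightarrow> nat \<Rightarrow> (nat \<times> nat) set set"
  where "staircases k l =
    {c. c \<subseteq> {..k} \<times> {..l} \<and> (\<forall>i j i' j'. (i, j) \<in> c \<longrightarrow> (i', j') \<in> c \<longrightarrow> i < i' \<longrightarrow> j \<le> j')}"

lemma staircasesI:
  assumes "c \<subseteq> {..k} \<times> {..l}"
    and "\<And>i j i' j'. (i, j) \<in> c \<Longrightarrow> (i', j') \<in> c \<Longrightarrow> i < i' \<Longrightarrow> j \<le> j'"
  shows "c \<in> staircases k l"
  unfolding staircases_def by (intro CollectI conjI allI impI assms)

lemma staircasesD:
  assumes "c \<in> staircases k l"
  shows "c \<subseteq> {..k} \<times> {..l}"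
    and "(i, j) \<in> c \<Longrightarrow> (i', j') \<in> c \<Longrightarrow> i < i' \<Longrightarrow> j \<le> j'"
proof -
  note * = assms[unfolded staircases_def mem_Collect_eq]
  show "c \<subseteq> {..k} \<times> {..l}"
    by (rule conjunct1[OF *])
  show "(i, j) \<in> c \<Longrightarrow> (i', j') \<in> c \<Longrightarrow> i < i' \<Longrightarrow> j \<le> j'"
    by (rule conjunct2[OF *, rule_format])
qed

text \<open>A staircase cannot meet both the region to the right of and below the corner \<open>(s, t)\<close> and
  the region to its left and above.  So the mass in the rectangle below and to the left of the
  corner is the whole mass of the first \<open>s\<close> columns or the whole mass of the first \<open>t\<close> rows, whichever is smaller: weights
  on a staircase form the comonotone coupling of their marginals.\<close>

lemma staircase_cumulative:
  fixes w :: "nat \<times> nat \<Rightarrow> real"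
  assumes c: "c \<in> staircases k l" and w: "\<And>e. 0 \<le> w e" "\<And>e. e \<notin> c \<Longrightarrow> w e = 0"
    and st: "s \<le> Suc k" "t \<le> Suc l"
  shows "(\<Sum>i<s. \<Sum>j<t. w (i, j)) = min (\<Sum>i<s. \<Sum>j\<le>l. w (i, j)) (\<Sum>j<t. \<Sum>i\<le>k. w (i, j))"
    (is "?W = min ?X ?Y")
proof -
  have swap: "?W = (\<Sum>j<t. \<Sum>i<s. w (i, j))"
    by (rule sum.swap)
  have "?W \<le> ?X"
    using w(1) st by (intro sum_mono sum_mono2) auto
  moreover have "?W \<le> ?Y"
    unfolding swap using w(1) st by (intro sum_mono sum_mono2) auto
  moreover have "?W = ?X \<or> ?W = ?Y"
  proof (cases "\<forall>i<s. \<forall>j. t \<le> j \<longrightarrow> w (i, j) = 0")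
    case True
    then have "?W = ?X"
      using st by (intro sum.cong sum.mono_neutral_left) auto
    then show ?thesis ..
  next
    case False
    then obtain i1 j1 where 1: "i1 < s" "t \<le> j1" "w (i1, j1) \<noteq> 0"
      by blast
    have "w (i, j) = 0" if "s \<le> i" "j < t" for i j
    proof (rule ccontr)
      assume "w (i, j) \<noteq> 0"
      then have "(i1, j1) \<in> c" "(i, j) \<in> c"
        using 1 w(2) by blast+
      then have "j1 \<le> j"
        using staircasesD(2)[OF c, of i1 j1 i j] 1(1) that(1) by simp
      then show False
        using 1(2) that(2) by simp
    qed
    then have "?W = ?Y"
      unfolding swap using st by (intro sum.cong sum.mono_neutral_left) auto
    then show ?thesis ..
  qed
  ultimately show ?thesis
    by linarith
qed

lemma staircase_weights_unique:
  fixes w w' :: "nat \<times> nat \<Rightarrow> real"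
  assumes c: "c \<in> staircases k l" and w: "\<And>e. 0 \<le> w e" "\<And>e. e \<notin> c \<Longrightarrow> w e = 0"
    and c': "c' \<in> staircases k l" and w': "\<And>e. 0 \<le> w' e" "\<And>e. e \<notin> c' \<Longrightarrow> w' e = 0"
    and marg1: "\<And>i. (\<Sum>j\<le>l. w (i, j)) = (\<Sum>j\<le>l. w' (i, j))"
    and marg2: "\<And>j. (\<Sum>i\<le>k. w (i, j)) = (\<Sum>i\<le>k. w' (i, j))"
  shows "w = w'"
proof
  fix e :: "nat \<times> nat"
  obtain i j where e: "e = (i, j)"
    by (rule prod.exhaust)
  show "w e = w' e"
  proof (cases "i \<le> k \<and> j \<le> l")
    case True
    define W where "W u s t = (\<Sum>i<s. \<Sum>j<t. u (i, j))" for u :: "nat \<times> nat \<Rightarrow> real" and s t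
    \<comment> \<open>a weight is the mixed difference of the cumulative weights, which the marginals determine\<close>
    have cum: "W w s t = W w' s t" if "s \<le> Suc k" "t \<le> Suc l" for s t
      using staircase_cumulative[of c k l w s t, OF c w that]
        staircase_cumulative[of c' k l w' s t, OF c' w' that]
      by (simp add: W_def marg1 marg2)
    have diff: "u (i, j) = W u (Suc i) (Suc j) - W u i (Suc j) - W u (Suc i) j + W u i j" for u
      by (simp add: W_def)
    show ?thesis
      unfolding e diff[of w] diff[of w'] using True by (simp add: cum)
  next
    case False
    then have "e \<notin> c" "e \<notin> c'"
      using staircasesD(1)[OF c] staircasesD(1)[OF c'] e by auto
    then show ?thesis
      using w w' by simp
  qed
qed

text \<open>Conversely the mixed differences of \<open>min (X s) (Y t)\<close>, where \<open>X\<close> and \<open>Y\<close> are the cumulative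
  sums, are the weights of a staircase with the prescribed marginals: \<open>w (i, j)\<close> is the length of
  the overlap of the intervals from \<open>X i\<close> to \<open>X (i + 1)\<close> and from \<open>Y j\<close> to \<open>Y (j + 1)\<close>.\<close>

lemma ex_staircase_weights:
  fixes x y :: "nat \<Rightarrow> real"
  assumes x: "\<And>i. 0 \<le> x i" "(\<Sum>i\<le>k. x i) = 1" and y: "\<And>j. 0 \<le> y j" "(\<Sum>j\<le>l. y j) = 1"
  obtains w where "\<And>e. 0 \<le> w e" "{e. w e \<noteq> 0} \<in> staircases k l"
    "\<And>i. i \<le> k \<Longrightarrow> (\<Sum>j\<le>l. w (i, j)) = x i" "\<And>j. j \<le> l \<Longrightarrow> (\<Sum>i\<le>k. w (i, j)) = y j"
proof -
  define X where "X s = (\<Sum>i<s. x i)" for s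
  define Y where "Y t = (\<Sum>j<t. y j)" for t
  define M where "M s t = min (X s) (Y t)" for s t
  define w where "w = (\<lambda>(i, j). if i \<le> k \<and> j \<le> l
    then M (Suc i) (Suc j) - M i (Suc j) - M (Suc i) j + M i j else 0)"
  have Xmono: "X s \<le> X s'" if "s \<le> s'" for s s'
    unfolding X_def using that x(1) by (intro sum_mono2) auto
  have Ymono: "Y t \<le> Y t'" if "t \<le> t'" for t t'
    unfolding Y_def using that y(1) by (intro sum_mono2) auto
  have X1: "X (Suc k) = 1" and Y1: "Y (Suc l) = 1"
    using x(2) y(2) by (simp_all add: X_def Y_def lessThan_Suc_atMost)
  have M0: "M s 0 = 0" "M 0 t = 0" for s t
    using Xmono[of 0 s] Ymono[of 0 t] by (simp_all add: M_def X_def Y_def)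
  have Mk: "M (Suc k) t = Y t" if "t \<le> Suc l" for t
    using Ymono[OF that] X1 Y1 by (simp add: M_def)
  have Ml: "M s (Suc l) = X s" if "s \<le> Suc k" for s
    using Xmono[OF that] X1 Y1 by (simp add: M_def)
  show thesis
  proof
    show "0 \<le> w e" for e
      using Xmono[of "fst e" "Suc (fst e)"] Ymono[of "snd e" "Suc (snd e)"]
      by (auto simp: w_def M_def min_def split: prod.splits)
    have pos: "i \<le> k" "j \<le> l" "Y j < X (Suc i)" "X i < Y (Suc j)" if "w (i, j) \<noteq> 0" for i j
      using that Xmono[of i "Suc i"] Ymono[of j "Suc j"]
      by (auto simp: w_def M_def min_def split: if_splits)
    have "j \<le> j'" if "w (i, j) \<noteq> 0" "w (i', j') \<noteq> 0" "i < i'" for i j i' j'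
    proof (rule ccontr)
      assume "\<not> j \<le> j'"
      then have "Y (Suc j') \<le> Y j" "X (Suc i) \<le> X i'"
        using that(3) by (auto intro: Xmono Ymono)
      then show False
        using pos(3)[OF that(1)] pos(4)[OF that(2)] by linarith
    qed
    then show "{e. w e \<noteq> 0} \<in> staircases k l"
      using pos(1,2) by (intro staircasesI) auto
    show "(\<Sum>j\<le>l. w (i, j)) = x i" if "i \<le> k" for i
    proof -
      have "(\<Sum>j\<le>l. w (i, j)) = (\<Sum>j<Suc l. (M (Suc i) (Suc j) - M i (Suc j)) - (M (Suc i) j - M i j))"
        using that by (intro sum.cong) (auto simp: w_def)
      also have "\<dots> = M (Suc i) (Suc l) - M i (Suc l)"
        unfolding sum_lessThan_telescope[of "\<lambda>t. M (Suc i) t - M i t" "Suc l"] by (simp add: M0)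
      also have "\<dots> = x i"
        using that by (simp add: Ml X_def)
      finally show ?thesis .
    qed
    show "(\<Sum>i\<le>k. w (i, j)) = y j" if "j \<le> l" for j
    proof -
      have "(\<Sum>i\<le>k. w (i, j)) = (\<Sum>i<Suc k. (M (Suc i) (Suc j) - M (Suc i) j) - (M i (Suc j) - M i j))"
        using that by (intro sum.cong) (auto simp: w_def)
      also have "\<dots> = M (Suc k) (Suc j) - M (Suc k) j"
        unfolding sum_lessThan_telescope[of "\<lambda>s. M s (Suc j) - M s j" "Suc k"] by (simp add: M0)
      also have "\<dots> = y j"
        using that by (simp add: Mk Y_def)
      finally show ?thesis .
    qed
  qed
qed

locale simplex_product =
  fixes k l :: nat and a :: "nat \<Rightarrow> 'a::euclidean_space" and b :: "nat \<Rightarrow> 'b::euclidean_space"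
  assumes inj_a: "inj_on a {..k}" and indep_a: "\<not> affine_dependent (a ` {..k})"
    and inj_b: "inj_on b {..l}" and indep_b: "\<not> affine_dependent (b ` {..l})"
begin

abbreviation vertex :: "nat \<times> nat \<Rightarrow> 'a \<times> 'b"
  where "vertex \<equiv> \<lambda>(i, j). (a i, b j)"

lemma finite_staircase: "c \<in> staircases k l \<Longrightarrow> finite c"
  by (rule finite_subset[OF staircasesD(1)[of c k l]]) simp_all

lemma marginals:
  assumes "c \<in> staircases k l" "convex_weights vertex c w p"
  shows "convex_weights a {..k} (\<lambda>i. \<Sum>j\<le>l. w (i, j)) (fst p)"
    "convex_weights b {..l} (\<lambda>j. \<Sum>i\<le>k. w (i, j)) (snd p)"
proof -
  have "c \<subseteq> {..k} \<times> {..l}"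
    by (rule staircasesD(1)[OF assms(1)])
  then have w: "convex_weights vertex ({..k} \<times> {..l}) w (fst p, snd p)"
    using convex_weights_mono[OF assms(2)] by simp
  then have "\<And>e. 0 \<le> w e" "\<And>e. e \<notin> {..k} \<times> {..l} \<Longrightarrow> w e = 0"
    by (auto simp: convex_weights_def)
  from iffD1[OF convex_weights_product_iff[OF _ _ this] w]
  show "convex_weights a {..k} (\<lambda>i. \<Sum>j\<le>l. w (i, j)) (fst p)"
    "convex_weights b {..l} (\<lambda>j. \<Sum>i\<le>k. w (i, j)) (snd p)"
    by auto
qed

lemmas unique_a = unique_weights_if_affine_independent[OF finite_atMost inj_a indep_a]
  and unique_b = unique_weights_if_affine_independent[OF finite_atMost inj_b indep_b]

text \<open>The marginals of the weights are the barycentric coordinates of the two components of the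
  point, and weights on a staircase are determined by their marginals.\<close>

sublocale unique_coordinates "staircases k l" vertex
proof
  show "finite (staircases k l)"
    by (rule finite_subset[of _ "Pow ({..k} \<times> {..l})"]) (use staircasesD(1) in auto)
  show "c \<in> staircases k l \<Longrightarrow> finite c" for c
    by (rule finite_staircase)
  show "c \<in> staircases k l \<Longrightarrow> d \<subseteq> c \<Longrightarrow> d \<in> staircases k l" for c d
    by (rule staircasesI) (use staircasesD in blast)+
  show "w = w'" if c: "c \<in> staircases k l" "c' \<in> staircases k l"
    and w: "convex_weights vertex c w p" "convex_weights vertex c' w' p" for c c' w w' p
  proof (rule staircase_weights_unique[OF c(1) _ _ c(2)])
    show "(\<Sum>j\<le>l. w (i, j)) = (\<Sum>j\<le>l. w' (i, j))" for i
      by (rule fun_cong[OF unique_a[OF marginals(1)[OF c(1) w(1)] marginals(1)[OF c(2) w(2)]]])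
    show "(\<Sum>i\<le>k. w (i, j)) = (\<Sum>i\<le>k. w' (i, j))" for j
      by (rule fun_cong[OF unique_b[OF marginals(2)[OF c(1) w(1)] marginals(2)[OF c(2) w(2)]]])
  qed (use w in \<open>auto simp: convex_weights_def\<close>)
qed

lemma realization_eq_product: "realization = (convex hull (a ` {..k})) \<times> (convex hull (b ` {..l}))"
proof (intro subset_antisym subsetI)
  fix p assume "p \<in> realization"
  then obtain c w where "c \<in> staircases k l" "convex_weights vertex c w p"
    by (rule weights_of_point)
  from marginals[OF this] have "fst p \<in> convex hull (a ` {..k})" "snd p \<in> convex hull (b ` {..l})"
    using convex_hull_image_weights[OF _ inj_a] convex_hull_image_weights[OF _ inj_b] by blast+
  then show "p \<in> (convex hull (a ` {..k})) \<times> (convex hull (b ` {..l}))"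
    by (simp add: mem_Times_iff)
next
  fix p assume "p \<in> (convex hull (a ` {..k})) \<times> (convex hull (b ` {..l}))"
  then obtain x y where xy: "convex_weights a {..k} x (fst p)" "convex_weights b {..l} y (snd p)"
    using convex_hull_image_weights[OF _ inj_a] convex_hull_image_weights[OF _ inj_b]
    by (auto simp: mem_Times_iff)
  then obtain w where w: "\<And>e. 0 \<le> w e" "{e. w e \<noteq> 0} \<in> staircases k l"
    "\<And>i. i \<le> k \<Longrightarrow> (\<Sum>j\<le>l. w (i, j)) = x i" "\<And>j. j \<le> l \<Longrightarrow> (\<Sum>i\<le>k. w (i, j)) = y j"
    using ex_staircase_weights[of x k y l] unfolding convex_weights_def by blast
  have out: "w e = 0" if "e \<notin> {..k} \<times> {..l}" for e
    using staircasesD(1)[OF w(2)] that by auto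
  have "(\<Sum>j\<le>l. w (i, j)) = x i" for i
    using w(3) xy(1) out by (cases "i \<le> k") (simp_all add: convex_weights_def)
  moreover have "(\<Sum>i\<le>k. w (i, j)) = y j" for j
    using w(4) xy(2) out by (cases "j \<le> l") (simp_all add: convex_weights_def)
  ultimately have "convex_weights vertex ({..k} \<times> {..l}) w (fst p, snd p)"
    using xy convex_weights_product_iff[of "{..k}" "{..l}" w a b "fst p" "snd p", OF _ _ w(1) out] by simp
  then have "convex_weights vertex {e. w e \<noteq> 0} w p"
    unfolding prod.collapse by (rule convex_weights_restrict) (use out in auto)
  then have "p \<in> geo {e. w e \<noteq> 0}"
    using geo_iff_weights[OF w(2)] by blast
  then show "p \<in> realization"
    using w(2) by (auto simp: realization_def)
qed

text \<open>The barycentric coordinate of the first component at \<open>a i\<close> is the total weight of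
  column \<open>i\<close>.\<close>

lemma fst_in_rel_interior_iff:
  assumes "p \<in> realization"
  shows "fst p \<in> rel_interior (convex hull (a ` {..k})) \<longleftrightarrow> (\<forall>i\<le>k. \<exists>j. (i, j) \<in> carrier_face p)"
proof -
  obtain c w where c: "c \<in> staircases k l" "convex_weights vertex c w p"
    and carrier: "carrier_face p = {e. w e \<noteq> 0}"
    using assms by (rule weights_of_point)
  define x where "x i = (\<Sum>j\<le>l. w (i, j))" for i
  have x: "convex_weights a {..k} x (fst p)"
    using marginals(1)[OF c] by (simp add: x_def[abs_def])
  have "x i > 0 \<longleftrightarrow> (\<exists>j. (i, j) \<in> carrier_face p)" for i
  proof -
    have w: "\<And>e. 0 \<le> w e" "\<And>e. e \<notin> c \<Longrightarrow> w e = 0"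
      using c(2) unfolding convex_weights_def by blast+
    have "x i = 0 \<longleftrightarrow> (\<forall>j\<in>{..l}. w (i, j) = 0)"
      unfolding x_def by (rule sum_nonneg_eq_0_iff) (simp_all add: w(1))
    also have "\<dots> \<longleftrightarrow> (\<forall>j. w (i, j) = 0)"
      using w(2) staircasesD(1)[OF c(1)] by blast
    finally have "x i \<noteq> 0 \<longleftrightarrow> (\<exists>j. (i, j) \<in> carrier_face p)"
      by (simp add: carrier)
    moreover have "0 \<le> x i"
      unfolding x_def by (simp add: sum_nonneg w(1))
    ultimately show ?thesis
      by (auto simp: less_le)
  qed
  moreover have "fst p \<in> rel_interior (convex hull (a ` {..k})) \<longleftrightarrow> (\<forall>i\<le>k. x i > 0)"
  proof
    assume "fst p \<in> rel_interior (convex hull (a ` {..k}))"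
    then obtain u where u: "\<forall>z\<in>a ` {..k}. 0 < u z" "sum u (a ` {..k}) = 1"
      "(\<Sum>z\<in>a ` {..k}. u z *\<^sub>R z) = fst p"
      unfolding rel_interior_convex_hull_explicit[OF indep_a] by (elim CollectE exE conjE)
    have "\<forall>i\<le>k. 0 \<le> u (a i)"
      using u(1) by (simp add: order_less_imp_le)
    then have "convex_weights a {..k} (\<lambda>i. if i \<le> k then u (a i) else 0) (fst p)"
      using u(2,3) by (simp add: convex_weights_def sum.reindex[OF inj_a])
    from unique_a[OF x this] show "\<forall>i\<le>k. x i > 0"
      using u(1) by simp
  next
    assume pos: "\<forall>i\<le>k. x i > 0"
    let ?u = "\<lambda>z. x (the_inv_into {..k} a z)"
    have inv: "?u (a i) = x i" if "i \<le> k" for i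
      using that inj_a by (simp add: the_inv_into_f_f)
    have "sum ?u (a ` {..k}) = sum x {..k}"
      using inv by (simp add: sum.reindex[OF inj_a])
    moreover have "(\<Sum>z\<in>a ` {..k}. ?u z *\<^sub>R z) = (\<Sum>i\<le>k. x i *\<^sub>R a i)"
      using inv by (simp add: sum.reindex[OF inj_a])
    ultimately have "\<forall>z\<in>a ` {..k}. 0 < ?u z" "sum ?u (a ` {..k}) = 1"
      "(\<Sum>z\<in>a ` {..k}. ?u z *\<^sub>R z) = fst p"
      using pos inv x by (auto simp: convex_weights_def)
    then show "fst p \<in> rel_interior (convex hull (a ` {..k}))"
      unfolding rel_interior_convex_hull_explicit[OF indep_a] by (intro CollectI exI conjI)
  qed
  ultimately show ?thesis
    by simp
qed

end

section \<open>The tiles of the handle\<close>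

context simplex_product
begin

text \<open>A lattice path from \<open>(0, 0)\<close> to \<open>(k, l)\<close> runs through column \<open>i\<close> from row \<open>\<tau> i\<close> to
  row \<open>\<tau> (Suc i)\<close>.  The fixed values at \<open>0\<close> and beyond \<open>k\<close> make \<open>\<tau>\<close> determined by its path.\<close>

definition profiles :: "(nat \<Rightarrow> nat) set"
  where "profiles = {\<tau>. mono \<tau> \<and> \<tau> 0 = 0 \<and> (\<forall>i>k. \<tau> i = l)}"

definition lattice_path :: "(nat \<Rightarrow> nat) \<Rightarrow> (nat \<times> nat) set"
  where "lattice_path \<tau> = (SIGMA i:{..k}. {\<tau> i..\<tau> (Suc i)})"

text \<open>A path that enters the last column in row \<open>l\<close> meets that column in one vertex; then
  the face opposite to the last column is a facet and is removed as such.  Otherwise it has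
  codimension at least two and becomes the Morse face.\<close>

definition required :: "(nat \<Rightarrow> nat) \<Rightarrow> (nat \<times> nat) set"
  where "required \<tau> = (\<lambda>i. (i, \<tau> (Suc i))) ` (if \<tau> k = l then {..k} else {..<k})"

definition face_before_last_column :: "(nat \<Rightarrow> nat) \<Rightarrow> (nat \<times> nat) set"
  where "face_before_last_column \<tau> =
    (if \<tau> k = l then {} else SIGMA i:{..<k}. {\<tau> i..\<tau> (Suc i)})"

definition handle_tile :: "(nat \<Rightarrow> nat) \<Rightarrow> ('a \<times> 'b) set"
  where "handle_tile \<tau> = tile (lattice_path \<tau>) (required \<tau>) (face_before_last_column \<tau>)"

definition handle :: "('a \<times> 'b) set"
  where "handle = rel_interior (convex hull (a ` {..k})) \<times> (convex hull (b ` {..l}))"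

lemma profilesD:
  assumes "\<tau> \<in> profiles"
  shows "i \<le> j \<Longrightarrow> \<tau> i \<le> \<tau> j" "\<tau> 0 = 0" "k < i \<Longrightarrow> \<tau> i = l" "\<tau> i \<le> l"
proof -
  have *: "mono \<tau>" "\<tau> 0 = 0" "\<forall>i>k. \<tau> i = l"
    using assms unfolding profiles_def by blast+
  show mono: "i \<le> j \<Longrightarrow> \<tau> i \<le> \<tau> j" for i j
    by (rule monoD[OF *(1)])
  show "\<tau> 0 = 0" and last: "k < i \<Longrightarrow> \<tau> i = l" for i
    using *(2,3) by blast+
  show "\<tau> i \<le> l"
    using mono[of i "i + Suc k"] last[of "i + Suc k"] by simp
qed

lemma finite_profiles: "finite profiles"
proof (rule finite_subset)
  show "profiles \<subseteq> {\<tau>. \<forall>i. (i \<in> {..k} \<longrightarrow> \<tau> i \<in> {..l}) \<and> (i \<notin> {..k} \<longrightarrow> \<tau> i = l)}"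
    by (auto simp: profilesD(3,4) not_le)
  show "finite {\<tau>. \<forall>i. (i \<in> {..k} \<longrightarrow> \<tau> i \<in> {..l}) \<and> (i \<notin> {..k} \<longrightarrow> \<tau> i = l)}"
    by (rule finite_set_of_finite_funs) simp_all
qed

lemma path_in_staircases:
  assumes "\<tau> \<in> profiles"
  shows "lattice_path \<tau> \<in> staircases k l"
proof (rule staircasesI)
  show "lattice_path \<tau> \<subseteq> {..k} \<times> {..l}"
    using profilesD(4)[OF assms] by (auto simp: lattice_path_def intro: order_trans)
  show "j \<le> j'" if "(i, j) \<in> lattice_path \<tau>" "(i', j') \<in> lattice_path \<tau>" "i < i'" for i j i' j'
    using that profilesD(1)[OF assms, of "Suc i" i'] by (auto simp: lattice_path_def)
qed

lemma card_columns:
  assumes "\<tau> \<in> profiles"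
  shows "card (SIGMA i:{..<m}. {\<tau> i..\<tau> (Suc i)}) = m + \<tau> m"
proof -
  have "(\<Sum>i<m. Suc (\<tau> (Suc i)) - \<tau> i) = m + \<tau> m"
  proof (induction m)
    case (Suc m)
    then show ?case
      using profilesD(1)[OF assms, of m "Suc m"] by simp
  qed (simp add: profilesD(2)[OF assms])
  then show ?thesis
    by simp
qed

lemma card_path: "\<tau> \<in> profiles \<Longrightarrow> card (lattice_path \<tau>) = Suc (k + l)"
  unfolding lattice_path_def lessThan_Suc_atMost[symmetric]
  using card_columns[of \<tau> "Suc k"] profilesD(3)[of \<tau> "Suc k"] by linarith

lemma card_required: "card (required \<tau>) = (if \<tau> k = l then Suc k else k)"
  by (simp add: required_def card_image inj_on_def)

lemma required_subset_path: "\<tau> \<in> profiles \<Longrightarrow> required \<tau> \<subseteq> lattice_path \<tau>"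
  using profilesD(1)[of \<tau>] by (auto simp: required_def lattice_path_def)

lemma face_before_last_column_subset: "face_before_last_column \<tau> \<subseteq> lattice_path \<tau>"
  by (auto simp: face_before_last_column_def lattice_path_def)

text \<open>In every column before the last the top vertex of the path is required.  Of the last column
  some vertex is required: this removes a facet if the path has one vertex there, and a face of
  higher codimension otherwise.\<close>

lemma mem_handle_tile_iff:
  assumes "\<tau> \<in> profiles"
  shows "p \<in> handle_tile \<tau> \<longleftrightarrow> p \<in> realization \<and> carrier_face p \<subseteq> lattice_path \<tau> \<and>
    (\<forall>i<k. (i, \<tau> (Suc i)) \<in> carrier_face p) \<and> (\<exists>j. (k, j) \<in> carrier_face p)"
proof -
  have "required \<tau> \<subseteq> c \<and> \<not> c \<subseteq> face_before_last_column \<tau> \<longleftrightarrow>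
      (\<forall>i<k. (i, \<tau> (Suc i)) \<in> c) \<and> (\<exists>j. (k, j) \<in> c)"
    if "c \<subseteq> lattice_path \<tau>" "c \<noteq> {}" for c
  proof (cases "\<tau> k = l")
    case True
    then have "j = \<tau> (Suc k)" if "(k, j) \<in> c" for j
      using that \<open>c \<subseteq> lattice_path \<tau>\<close> profilesD(3)[OF assms, of "Suc k"] by (auto simp: lattice_path_def)
    moreover have "required \<tau> \<subseteq> c \<longleftrightarrow> (\<forall>i<k. (i, \<tau> (Suc i)) \<in> c) \<and> (k, \<tau> (Suc k)) \<in> c"
      using True by (auto simp: required_def le_less)
    ultimately show ?thesis
      using True \<open>c \<noteq> {}\<close> by (auto simp: face_before_last_column_def)
  next
    case False
    have "required \<tau> \<subseteq> c \<longleftrightarrow> (\<forall>i<k. (i, \<tau> (Suc i)) \<in> c)"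
      using False by (auto simp: required_def)
    moreover have "face_before_last_column \<tau> = {e \<in> lattice_path \<tau>. fst e \<noteq> k}"
      using False by (auto simp: face_before_last_column_def lattice_path_def)
    then have "c \<subseteq> face_before_last_column \<tau> \<longleftrightarrow> (\<forall>j. (k, j) \<notin> c)"
      using \<open>c \<subseteq> lattice_path \<tau>\<close> by auto
    ultimately show ?thesis
      by blast
  qed
  from this[of "carrier_face p"] show ?thesis
    unfolding handle_tile_def mem_tile_iff[OF path_in_staircases[OF assms] face_before_last_column_subset]
    using carrier_face_in(2)[of p] by blast
qed

lemma morse_tile_data_handle_tile:
  assumes "\<tau> \<in> profiles"
  shows "morse_tile_data (k + l) (if \<tau> k = l then Suc k else k) (geo (lattice_path \<tau>))
    ((\<lambda>i. geo (lattice_path \<tau> - {i})) ` required \<tau>) (geo (face_before_last_column \<tau>))"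
proof -
  have "lattice_path \<tau> \<noteq> {}"
    using card_path[OF assms] by auto
  moreover have "face_before_last_column \<tau> = {} \<or> required \<tau> \<noteq> {} \<and>
    required \<tau> \<subseteq> face_before_last_column \<tau> \<and> card (face_before_last_column \<tau>) + 2 \<le> card (lattice_path \<tau>)"
  proof (cases "\<tau> k = l \<or> k = 0")
    case True
    then show ?thesis
      by (auto simp: face_before_last_column_def)
  next
    case False
    then have "\<tau> k < l"
      using profilesD(4)[OF assms, of k] by simp
    moreover have "required \<tau> \<subseteq> face_before_last_column \<tau>"
      using False profilesD(1)[OF assms] by (auto simp: required_def face_before_last_column_def)
    moreover have "required \<tau> \<noteq> {}"
      using False by (auto simp: required_def lessThan_empty_iff)
    ultimately show ?thesis
      using card_columns[OF assms, of k] card_path[OF assms] False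
      by (simp add: face_before_last_column_def)
  qed
  ultimately show ?thesis
    using morse_tile_data_tile[OF path_in_staircases[OF assms] required_subset_path[OF assms]
        face_before_last_column_subset] card_path[OF assms] card_required[of \<tau>] by simp
qed

lemma handle_tile_eq:
  "handle_tile \<tau> = geo (lattice_path \<tau>) - \<Union>((\<lambda>i. geo (lattice_path \<tau> - {i})) ` required \<tau>)
    - geo (face_before_last_column \<tau>)"
  by (simp add: handle_tile_def tile_def)

lemma aff_dim_handle_tile: "\<tau> \<in> profiles \<Longrightarrow> aff_dim (handle_tile \<tau>) = int (k + l)"
  using aff_dim_morse_tile[OF morse_tile_data_handle_tile handle_tile_eq] by simp

lemma handle_tile_nonempty: "\<tau> \<in> profiles \<Longrightarrow> handle_tile \<tau> \<noteq> {}"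
  using aff_dim_handle_tile[of \<tau>] by auto

lemma handle_tile_subset_geo: "handle_tile \<tau> \<subseteq> geo (lattice_path \<tau>)"
  by (auto simp: handle_tile_eq)

lemma mem_handle_iff: "p \<in> handle \<longleftrightarrow> p \<in> realization \<and> (\<forall>i\<le>k. \<exists>j. (i, j) \<in> carrier_face p)"
proof -
  have "p \<in> handle \<longleftrightarrow> p \<in> realization \<and> fst p \<in> rel_interior (convex hull (a ` {..k}))"
    unfolding handle_def realization_eq_product mem_Times_iff using rel_interior_subset by blast
  then show ?thesis
    using fst_in_rel_interior_iff by blast
qed

lemma handle_tile_subset_handle: "\<tau> \<in> profiles \<Longrightarrow> handle_tile \<tau> \<subseteq> handle"
proof
  fix p assume "\<tau> \<in> profiles" "p \<in> handle_tile \<tau>"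
  then have "p \<in> realization" "\<And>i. i < k \<Longrightarrow> (i, \<tau> (Suc i)) \<in> carrier_face p" "\<exists>j. (k, j) \<in> carrier_face p"
    by (simp_all add: mem_handle_tile_iff)
  then show "p \<in> handle"
    unfolding mem_handle_iff by (metis le_neq_implies_less)
qed

text \<open>The tile of a point of the handle is read off from its carrier: the path must turn right at
  the topmost vertex of the carrier in each column before the last.\<close>

lemma handle_subset_tiles:
  assumes "p \<in> handle"
  shows "\<exists>\<tau>\<in>profiles. p \<in> handle_tile \<tau>"
proof -
  define c where "c = carrier_face p"
  have p: "p \<in> realization" and cols: "\<And>i. i \<le> k \<Longrightarrow> \<exists>j. (i, j) \<in> c"
    using assms by (auto simp: mem_handle_iff c_def)
  have c: "c \<in> staircases k l"
    using carrier_face_in(1)[OF p] by (simp add: c_def)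
  note grid = staircasesD(1)[OF c]
  define m where "m i = Max {j. (i, j) \<in> c}" for i
  have fin: "finite {j. (i, j) \<in> c}" for i
    by (rule finite_subset[of _ "{..l}"]) (use grid in auto)
  have m_in: "(i, m i) \<in> c" if "i \<le> k" for i
    using Max_in[OF fin, of i] cols[OF that] by (auto simp: m_def)
  have m_ge: "j \<le> m i" if "(i, j) \<in> c" for i j
    using Max_ge[OF fin, of j i] that by (simp add: m_def)
  define \<tau> where "\<tau> i = (case i of 0 \<Rightarrow> 0 | Suc i' \<Rightarrow> if i' < k then m i' else l)" for i
  have m_le: "m i \<le> l" if "i \<le> k" for i
    using m_in[OF that] grid by auto
  have step: "\<tau> n \<le> \<tau> (Suc n)" for n
  proof (cases n)
    case (Suc i)
    have "m i \<le> m (Suc i)" if "Suc i < k"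
      using staircasesD(2)[OF c, of i "m i" "Suc i" "m (Suc i)"] m_in that by simp
    then show ?thesis
      using m_le[of i] Suc by (simp add: \<tau>_def)
  qed (simp add: \<tau>_def)
  then have \<tau>: "\<tau> \<in> profiles"
    by (auto simp: profiles_def mono_iff_le_Suc) (auto simp: \<tau>_def split: nat.split)
  have "c \<subseteq> lattice_path \<tau>"
  proof
    fix e assume "e \<in> c"
    obtain i j where e: "e = (i, j)"
      by (rule prod.exhaust)
    have ij: "i \<le> k" "j \<le> l"
      using \<open>e \<in> c\<close> grid e by auto
    have "j \<le> \<tau> (Suc i)"
      using m_ge[of i j] \<open>e \<in> c\<close> e ij by (simp add: \<tau>_def)
    moreover have "\<tau> i \<le> j"
    proof (cases i)
      case (Suc i')
      then show ?thesis
        using staircasesD(2)[OF c, of i' "m i'" i j] m_in[of i'] \<open>e \<in> c\<close> e ij by (simp add: \<tau>_def)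
    qed (simp add: \<tau>_def)
    ultimately show "e \<in> lattice_path \<tau>"
      using ij by (simp add: e lattice_path_def)
  qed
  moreover have "(i, \<tau> (Suc i)) \<in> c" if "i < k" for i
    using m_in[of i] that by (simp add: \<tau>_def)
  ultimately have "p \<in> handle_tile \<tau>"
    using p cols[of k] \<tau> by (auto simp: mem_handle_tile_iff c_def)
  with \<tau> show ?thesis
    by blast
qed

text \<open>The required tops of the tile of \<open>\<tau>\<close> lie on the path of \<open>\<tau>'\<close>, hence not above it.\<close>

lemma handle_tile_meets_geo_path:
  assumes \<tau>: "\<tau> \<in> profiles" "\<tau>' \<in> profiles" and p: "p \<in> handle_tile \<tau>" "p \<in> geo (lattice_path \<tau>')"
  shows "\<tau> \<le> \<tau>'"
proof (rule le_funI)
  fix i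
  have carrier: "carrier_face p \<subseteq> lattice_path \<tau>'"
    using p(2) mem_geo_iff[OF path_in_staircases[OF \<tau>(2)]] by blast
  show "\<tau> i \<le> \<tau>' i"
  proof (cases i)
    case 0
    then show ?thesis
      using profilesD(2)[OF \<tau>(1)] by simp
  next
    case (Suc i')
    show ?thesis
    proof (cases "i' < k")
      case True
      then have "(i', \<tau> (Suc i')) \<in> lattice_path \<tau>'"
        using p(1) carrier by (auto simp: mem_handle_tile_iff[OF \<tau>(1)])
      then show ?thesis
        using Suc by (simp add: lattice_path_def)
    next
      case False
      then show ?thesis
        using Suc profilesD(3)[OF \<tau>(1), of i] profilesD(3)[OF \<tau>(2), of i] by simp
    qed
  qed
qed

lemma handle_tiles_disjoint:
  assumes "\<tau> \<in> profiles" "\<tau>' \<in> profiles" "p \<in> handle_tile \<tau>" "p \<in> handle_tile \<tau>'"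
  shows "\<tau> = \<tau>'"
  using handle_tile_meets_geo_path[of \<tau> \<tau>' p] handle_tile_meets_geo_path[of \<tau>' \<tau> p]
    handle_tile_subset_geo assms by (auto intro: antisym)

end

section \<open>The shelling\<close>

lemma ex_linear_extension:
  assumes "finite (A :: 'x::order set)"
  shows "\<exists>xs. set xs = A \<and> sorted_wrt (\<lambda>x y. \<not> y \<le> x) xs"
  using assms
proof (induction A rule: finite_psubset_induct)
  case (psubset A)
  show ?case
  proof (cases "A = {}")
    case False
    obtain m where m: "m \<in> A" "\<forall>x\<in>A. m \<le> x \<longrightarrow> m = x"
      using finite_has_maximal[OF psubset.hyps False] by blast
    then obtain xs where xs: "set xs = A - {m}" "sorted_wrt (\<lambda>x y. \<not> y \<le> x) xs"
      using psubset.IH[of "A - {m}"] by blast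
    have "set (xs @ [m]) = A" "sorted_wrt (\<lambda>x y. \<not> y \<le> x) (xs @ [m])"
      using m xs by (auto simp: sorted_wrt_append)
    then show ?thesis
      by blast
  qed simp
qed

context simplex_product
begin

lemma partition_on_handle: "partition_on handle (handle_tile ` profiles)"
proof (rule partition_onI)
  show "\<Union>(handle_tile ` profiles) = handle"
    using handle_tile_subset_handle handle_subset_tiles by blast
  show "disjnt T T'" if "T \<in> handle_tile ` profiles" "T' \<in> handle_tile ` profiles" "T \<noteq> T'" for T T'
    using that handle_tiles_disjoint unfolding disjnt_def by blast
  show "{} \<notin> handle_tile ` profiles"
    using handle_tile_nonempty by (metis imageE)
qed

lemma morse_tiling_handle: "morse_tiling (geo ` staircases k l) handle (handle_tile ` profiles)"
  unfolding morse_tiling_def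
proof (intro conjI ballI allI)
  show "handle \<subseteq> \<Union>(geo ` staircases k l)"
    using mem_handle_iff unfolding realization_def by blast
  show "partition_on handle (handle_tile ` profiles)"
    by (rule partition_on_handle)
  show "\<exists>s\<in>geo ` staircases k l. morse_tile_of s T" if T: "T \<in> handle_tile ` profiles" for T
  proof -
    obtain \<tau> where \<tau>: "\<tau> \<in> profiles" "T = handle_tile \<tau>"
      using T by blast
    have "morse_tile_of (geo (lattice_path \<tau>)) T"
      unfolding morse_tile_of_def \<tau>(2) using morse_tile_data_handle_tile[OF \<tau>(1)] handle_tile_eq by blast
    then show ?thesis
      using path_in_staircases[OF \<tau>(1)] by blast
  qed
  show "closedin (top_of_set handle) (\<Union>{T \<in> handle_tile ` profiles. aff_dim T \<ge> int j})" for j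
  proof (cases "j \<le> k + l")
    case True
    then have "{T \<in> handle_tile ` profiles. aff_dim T \<ge> int j} = handle_tile ` profiles"
      using aff_dim_handle_tile by auto
    then show ?thesis
      using partition_onD1[OF partition_on_handle] by simp
  next
    case False
    then have "{T \<in> handle_tile ` profiles. aff_dim T \<ge> int j} = {}"
      using aff_dim_handle_tile by auto
    then show ?thesis
      by (simp only: Union_empty closedin_empty)
  qed
qed

text \<open>If \<open>\<Theta>\<close> is closed downwards in the pointwise order, a point of the handle in one of
  the closed simplices belongs to a tile with a smaller profile, again in \<open>\<Theta>\<close>.\<close>

lemma closedin_down_closed_tiles:
  assumes "\<Theta> \<subseteq> profiles" and down: "\<And>\<tau> \<tau>'. \<tau> \<in> profiles \<Longrightarrow> \<tau>' \<in> \<Theta> \<Longrightarrow> \<tau> \<le> \<tau>' \<Longrightarrow> \<tau> \<in> \<Theta>"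
  shows "closedin (top_of_set handle) (\<Union>(handle_tile ` \<Theta>))"
proof -
  have "\<Union>(handle_tile ` \<Theta>) = handle \<inter> (\<Union>\<tau>\<in>\<Theta>. geo (lattice_path \<tau>))"
  proof (intro subset_antisym subsetI)
    fix p assume "p \<in> \<Union>(handle_tile ` \<Theta>)"
    then obtain \<tau> where "\<tau> \<in> \<Theta>" "p \<in> handle_tile \<tau>"
      by blast
    then show "p \<in> handle \<inter> (\<Union>\<tau>\<in>\<Theta>. geo (lattice_path \<tau>))"
      using assms(1) handle_tile_subset_handle[of \<tau>] handle_tile_subset_geo[of \<tau>] by blast
  next
    fix p assume "p \<in> handle \<inter> (\<Union>\<tau>\<in>\<Theta>. geo (lattice_path \<tau>))"
    then obtain \<tau>' where \<tau>': "\<tau>' \<in> \<Theta>" "p \<in> geo (lattice_path \<tau>')" and "p \<in> handle"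
      by blast
    then obtain \<tau> where \<tau>: "\<tau> \<in> profiles" "p \<in> handle_tile \<tau>"
      using handle_subset_tiles by blast
    have "\<tau>' \<in> profiles"
      using \<tau>'(1) assms(1) by blast
    then have "\<tau> \<le> \<tau>'"
      using \<tau> \<tau>'(2) handle_tile_meets_geo_path by blast
    then have "\<tau> \<in> \<Theta>"
      by (rule down[OF \<tau>(1) \<tau>'(1)])
    with \<tau>(2) show "p \<in> \<Union>(handle_tile ` \<Theta>)"
      by blast
  qed
  moreover have "closed (\<Union>\<tau>\<in>\<Theta>. geo (lattice_path \<tau>))"
  proof (intro closed_UN finite_subset[OF assms(1) finite_profiles] ballI)
    show "closed (geo (lattice_path \<tau>))" if "\<tau> \<in> \<Theta>" for \<tau>
      using that assms(1) path_in_staircases by (intro closed_simplex[OF simplex_geo]) blast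
  qed
  ultimately show ?thesis
    by (simp add: closedin_closed_Int)
qed

text \<open>Adding the tiles along a linear extension of the pointwise order of profiles keeps every
  stage closed downwards.\<close>

lemma morse_shelling_handle:
  "\<exists>N X. morse_shelling (geo ` staircases k l) handle (handle_tile ` profiles) N X"
proof -
  obtain ts where ts: "set ts = profiles" "sorted_wrt (\<lambda>x y. \<not> y \<le> x) ts"
    using ex_linear_extension[OF finite_profiles] by blast
  define X where "X m = \<Union>(handle_tile ` set (take m ts))" for m
  have order: "\<not> y \<le> x" if "x \<in> set (take m ts)" "y \<in> set (drop m ts)" for x y m
    using ts(2) that by (metis append_take_drop_id sorted_wrt_append)
  have sub: "set (take m ts) \<subseteq> profiles" for m
    using set_take_subset ts(1) by metis
  have closed: "closedin (top_of_set handle) (X m)" for m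
    unfolding X_def
  proof (rule closedin_down_closed_tiles[OF sub])
    fix \<tau> \<tau>' assume "\<tau> \<in> profiles" "\<tau>' \<in> set (take m ts)" "\<tau> \<le> \<tau>'"
    moreover have "profiles = set (take m ts) \<union> set (drop m ts)"
      using ts(1) by (metis append_take_drop_id set_append)
    ultimately show "\<tau> \<in> set (take m ts)"
      using order by blast
  qed
  have next_tile: "X i \<subset> X (Suc i) \<and> X (Suc i) - X i \<in> handle_tile ` profiles" if "i < length ts" for i
  proof -
    have "ts ! i \<in> set (drop i ts)"
      using that by (simp flip: Cons_nth_drop_Suc)
    then have \<tau>: "ts ! i \<in> profiles" "ts ! i \<notin> set (take i ts)"
      using ts(1) order[of "ts ! i" i "ts ! i"] by (auto dest: in_set_dropD)
    have step: "X (Suc i) = X i \<union> handle_tile (ts ! i)"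
      using that by (auto simp: X_def take_Suc_conv_app_nth)
    have "X i \<inter> handle_tile (ts ! i) = {}"
      using \<tau> sub handle_tiles_disjoint unfolding X_def by blast
    then show ?thesis
      using step handle_tile_nonempty[OF \<tau>(1)] \<tau>(1) by blast
  qed
  have "morse_tiled_subset handle (handle_tile ` profiles) (X m)" for m
    unfolding morse_tiled_subset_def
    using closed[of m] sub[of m] by (auto simp: X_def intro!: exI[of _ "handle_tile ` set (take m ts)"])
  moreover have "X 0 = {}" "X (length ts) = handle"
    using partition_onD1[OF partition_on_handle] ts(1) by (simp_all add: X_def)
  ultimately have "morse_shelling (geo ` staircases k l) handle (handle_tile ` profiles) (length ts) X"
    unfolding morse_shelling_def using morse_tiling_handle next_tile by blast
  then show ?thesis
    by blast
qed

definition lowest_profile :: "nat \<Rightarrow> nat"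
  where "lowest_profile i = (if i \<le> k then 0 else l)"

lemma lowest_profile_in: "lowest_profile \<in> profiles"
  by (auto simp: profiles_def lowest_profile_def mono_def)

lemma eq_lowest_profile:
  assumes "\<tau> \<in> profiles" "\<tau> k = 0"
  shows "\<tau> = lowest_profile"
proof
  show "\<tau> i = lowest_profile i" for i
    using assms profilesD(1)[OF assms(1), of i k] profilesD(3)[OF assms(1), of i]
    by (simp add: lowest_profile_def)
qed

lemma aff_dim_face_before_last_column:
  assumes "\<tau> \<in> profiles"
  shows "aff_dim (geo (face_before_last_column \<tau>)) = (if \<tau> k = l then - 1 else int (k + \<tau> k) - 1)"
proof -
  have "face_before_last_column \<tau> \<in> staircases k l"
    using path_in_staircases[OF assms] face_before_last_column_subset by (rule subset_closed)
  then show ?thesis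
    using aff_dim_geo card_columns[OF assms, of k] by (simp add: face_before_last_column_def)
qed

text \<open>For \<open>l = 0\<close> the only path has a single vertex in each column, so that all facets are
  removed and the tile is the open simplex.  For \<open>l > 0\<close> the lowest path runs along row \<open>0\<close> and
  then up the last column: \<open>k\<close> facets are removed, and the Morse face is spanned by the \<open>k\<close>
  vertices before the last column.  If moreover \<open>k = 0\<close>, this is the closed simplex.\<close>

lemma critical_lowest_tile: "critical_tile k (handle_tile lowest_profile)"
proof -
  note data = morse_tile_data_handle_tile[OF lowest_profile_in]
  have "lowest_profile k = 0"
    by (simp add: lowest_profile_def)
  then show ?thesis
    unfolding critical_tile_def
    using data handle_tile_eq[of lowest_profile] aff_dim_face_before_last_column[OF lowest_profile_in]
    by (intro exI conjI) (assumption | auto)+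
qed

text \<open>A path with at least two vertices in the last column has a Morse face of dimension
  \<open>k + \<tau> k - 1\<close>, which is the critical dimension \<open>k - 1\<close> only if the path climbs in the
  last column alone.\<close>

lemma critical_handle_tile:
  assumes \<tau>: "\<tau> \<in> profiles" and crit: "critical_tile i (handle_tile \<tau>)"
  shows "\<tau> = lowest_profile"
proof (cases "k = 0 \<or> l = 0")
  case True
  then have "\<tau> k = 0"
    using profilesD(2,4)[OF \<tau>] by auto
  with \<tau> show ?thesis
    by (rule eq_lowest_profile)
next
  case False
  obtain n' k' s R \<mu> where data': "morse_tile_data n' k' s R \<mu>" "handle_tile \<tau> = s - \<Union>R - \<mu>"
    and crit': "k' = 0 \<and> i = 0 \<or> k' = n' + 1 \<and> i = n' \<or>
      1 \<le> k' \<and> k' < n' \<and> aff_dim \<mu> = int k' - 1 \<and> i = k'"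
    using crit unfolding critical_tile_def by blast
  have eq: "n' = k + l" "k' = (if \<tau> k = l then Suc k else k)" "\<mu> = geo (face_before_last_column \<tau>)"
    using morse_tile_data_unique[OF morse_tile_data_handle_tile[OF \<tau>] data'(1)] data'(2)
      handle_tile_eq[of \<tau>] False by auto
  have "\<tau> k = 0"
    using crit' False aff_dim_face_before_last_column[OF \<tau>] unfolding eq by (auto split: if_splits)
  with \<tau> show ?thesis
    by (rule eq_lowest_profile)
qed

end

lemma simplex_vertices_enumeration:
  assumes "int k simplex A"
  obtains a where "inj_on a {..k}" "\<not> affine_dependent (a ` {..k})" "A = convex hull (a ` {..k})"
proof -
  obtain V where V: "finite V" "\<not> affine_dependent V" "int (card V) = int k + 1" "A = convex hull V"
    using assms unfolding simplex by blast
  then have "card V = card {..k}"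
    by simp
  then obtain a where "bij_betw a {..k} V"
    using finite_same_card_bij[OF finite_atMost V(1)] by metis
  then show thesis
    using that V by (auto simp: bij_betw_def)
qed

theorem theorem1p4:
  fixes k n :: nat
    and A :: "'a::euclidean_space set"
    and B :: "'b::euclidean_space set"
  assumes "k \<le> n"
    and "int k simplex A"
    and "int (n - k) simplex B"
  shows "\<exists>(K :: ('a \<times> 'b) set set) P N X.
           simplicial_complex K \<and> \<Union>K = A \<times> B \<and>
           morse_shelling K (rel_interior A \<times> B) P N X \<and>
           (\<exists>T\<in>P. critical_tile k T \<and> (\<forall>T'\<in>P. \<forall>i. critical_tile i T' \<longrightarrow> T' = T))"
proof -
  define l where "l = n - k"
  obtain a where a: "inj_on a {..k}" "\<not> affine_dependent (a ` {..k})" "A = convex hull (a ` {..k})"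
    using assms(2) by (rule simplex_vertices_enumeration)
  obtain b where b: "inj_on b {..l}" "\<not> affine_dependent (b ` {..l})" "B = convex hull (b ` {..l})"
    using assms(3) unfolding l_def by (rule simplex_vertices_enumeration)
  interpret simplex_product k l a b
    by unfold_locales (use a b in auto)
  have handle_eq: "rel_interior A \<times> B = handle"
    by (simp add: handle_def a(3) b(3))
  have union_eq: "\<Union>(geo ` staircases k l) = A \<times> B"
    using realization_eq_product by (simp add: realization_def a(3) b(3))
  obtain N X where shelling: "morse_shelling (geo ` staircases k l) handle (handle_tile ` profiles) N X"
    using morse_shelling_handle by blast
  have critical: "\<exists>T\<in>handle_tile ` profiles. critical_tile k T \<and>
      (\<forall>T'\<in>handle_tile ` profiles. \<forall>i. critical_tile i T' \<longrightarrow> T' = T)"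
    using lowest_profile_in critical_lowest_tile critical_handle_tile by blast
  show ?thesis
    unfolding handle_eq
    by (intro exI) (rule conjI[OF simplicial_complex_geo conjI[OF union_eq conjI[OF shelling critical]]])
qed

end
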